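(* Let $P(x)=\prod_{j=1}^n(x-e^{2\pi i\alpha_j})$ with $0\leq\alpha_1\leq\dots\leq\alpha_n<1$. Then \[m_3(P)=-\frac{3}{2}n^2\zeta(3)-3n\sum_{1\leq k<l\leq n}C_3(2\pi(\alpha_l-\alpha_k))-3\pi\sum_{1\leq k<l\leq n}S_2(2\pi(\alpha_l-\alpha_k))\bigl(n(\alpha_l-\alpha_k)-(l-k)\bigr).\]
   Context: $m_3(P)=\int_0^1\log^3|P(e^{2\pi i\theta})|\,d\theta$. The Clausen functions are $C_\ell(t)=\sum_{N=1}^\infty\frac{\cos(Nt)}{N^\ell}$ and $S_\ell(t)=\sum_{N=1}^\infty\frac{\sin(Nt)}{N^\ell}$; $\zeta$ is the Riemann zeta function. *)

theory Defs
  imports "HOL-Analysis.Analysis" "HOL-Computational_Algebra.Polynomial"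
begin

(* At a zero of P on the unit circle the integrand is ln 0 ^ 3 = 0 by convention;
   this affects only finitely many points. *)
definition m3 :: "complex poly \<Rightarrow> real" where
  "m3 P = (LINT \<theta>:{0..1}|lborel.
     (ln (cmod (poly P (exp (2 * of_real pi * \<i> * of_real \<theta>))))) ^ 3)"

(* In the three series the summation index is shifted: N = 0, 1, 2, ... here
   corresponds to N + 1 = 1, 2, 3, ... in the usual notation. *)
definition clausen_C :: "nat \<Rightarrow> real \<Rightarrow> real" where
  "clausen_C l t = (\<Sum>N. cos (real (Suc N) * t) / real (Suc N) ^ l)"

definition clausen_S :: "nat \<Rightarrow> real \<Rightarrow> real" where
  "clausen_S l t = (\<Sum>N. sin (real (Suc N) * t) / real (Suc N) ^ l)"

(* The Riemann zeta function at integer arguments s > 1, where the Dirichlet series converges. *)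
definition zeta :: "nat \<Rightarrow> real" where
  "zeta s = (\<Sum>N. 1 / real (Suc N) ^ s)"

end

theory Submission
  imports Defs "HOL-Complex_Analysis.Cauchy_Integral_Formula"
begin

text \<open>
  Write \<open>e x = exp (2 \<pi> i x)\<close>. On the unit circle, \<open>log |P|\<close> is the real part \<open>u\<close> of the boundary values
  \<open>u + i v\<close> of \<open>f z = (\<Sum>j. Ln (1 - z e (-\<alpha> j)))\<close>, which is holomorphic in the disc and vanishes at 0.
  Hence \<open>(u + i v)^3\<close> has mean 0, and its real part gives \<open>\<integral> u^3 = 3 \<integral> u v^2\<close>.
  Here \<open>v x = \<pi> (\<Sum>j. B (x - \<alpha> j))\<close> with the sawtooth \<open>B x = frac x - 1/2\<close>, and the numbers
  \<open>a = B (x - \<alpha> j)\<close> and \<open>b = B (x - \<alpha> k)\<close> satisfy \<open>(a - b - d)^2 = 1/4\<close> for a constant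
  \<open>d\<close> that is \<open>\<alpha> k - \<alpha> j\<close> shifted by \<open>1/2\<close> or \<open>-1/2\<close>.
  This expresses \<open>a b\<close> through \<open>a^2\<close>, \<open>b^2\<close>, \<open>a\<close>, \<open>b\<close> and constants, so that only the integrals of
  \<open>log |1 - e x|\<close> against \<open>1\<close>, \<open>B (x + s)\<close> and \<open>B (x + s)^2\<close> are needed. Their values
  \<open>0\<close>, \<open>S\<^sub>2 (2 \<pi> s) / (2 \<pi>)\<close> and \<open>- C\<^sub>3 (2 \<pi> s) / (2 \<pi>^2)\<close> follow from the Fourier series
  \<open>log |1 - e x| = - (\<Sum>N. cos (2 \<pi> N x) / N)\<close>, regularised by a radius \<open>r < 1\<close>.
\<close>

section \<open>Periodic functions on the unit interval\<close>

text \<open>Restricting the measure, rather than writing indicator functions, turns set integrals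
  into plain integrals over a finite measure. Dominated convergence and termwise integration then
  apply directly, and bounded measurable functions are integrable.\<close>

definition unit_interval :: "real measure" where
  "unit_interval = restrict_space lborel {0..1}"

lemma space_unit_interval [simp]: "space unit_interval = {0..1}"
  by (simp add: unit_interval_def)

interpretation unit_interval: finite_measure unit_interval
  by (intro finite_measureI) (simp add: unit_interval_def emeasure_restrict_space)

lemma measurable_unit_interval [measurable (raw)]:
  "f \<in> borel_measurable borel \<Longrightarrow> f \<in> borel_measurable unit_interval"
  unfolding unit_interval_def by (intro measurable_restrict_space1) simp

lemma set_integral_eq_unit_interval:
  fixes f :: "real \<Rightarrow> 'a :: {banach, second_countable_topology}"
  shows "(LINT x:{0..1}|lborel. f x) = integral\<^sup>L unit_interval f"
  unfolding unit_interval_def set_lebesgue_integral_def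
  by (subst integral_restrict_space) auto

lemma integrable_unit_interval_iff:
  fixes f :: "real \<Rightarrow> 'a :: {banach, second_countable_topology}"
  shows "integrable unit_interval f \<longleftrightarrow> set_integrable lborel {0..1} f"
  unfolding unit_interval_def set_integrable_def
  by (subst integrable_restrict_space) auto

lemma integrable_unit_interval_bounded:
  fixes f :: "real \<Rightarrow> 'a :: {banach, second_countable_topology}"
  assumes "f \<in> borel_measurable borel" "\<And>x. norm (f x) \<le> C"
  shows "integrable unit_interval f"
  by (rule unit_interval.integrable_const_bound[where B = C])
    (use assms in \<open>auto intro: measurable_unit_interval\<close>)

lemma AE_unit_interval_not_in_countable:
  assumes "countable A"
  shows "AE x in unit_interval. x \<notin> A"
proof -
  have "AE x in lborel. x \<notin> A"
    by (intro AE_not_in countable_imp_null_set_lborel assms)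
  thus ?thesis
    unfolding unit_interval_def by (subst AE_restrict_space_iff) auto
qed

lemma AE_unit_interval_shift_not_Ints:
  "AE x in unit_interval. x + s \<notin> \<int>"
proof -
  have "AE x in unit_interval. x \<notin> (\<lambda>k. k - s) ` \<int>"
    by (intro AE_unit_interval_not_in_countable countable_image countable_int)
  thus ?thesis
    by eventually_elim (force simp: image_iff)
qed

lemma periodic_add_int:
  fixes f :: "real \<Rightarrow> 'a"
  assumes "\<And>x. f (x + 1) = f x"
  shows "f (x + of_int k) = f x"
proof (induction k rule: int_induct[where k = 0])
  case (step1 i)
  thus ?case using assms[of "x + of_int i"] by (simp add: add_ac)
next
  case (step2 i)
  thus ?case using assms[of "x + of_int (i - 1)"] by (simp add: add_ac)
qed simp

text \<open>Only the fractional part \<open>t\<close> of \<open>s\<close> matters. Cut the interval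
  at \<open>t\<close>: the piece from \<open>t\<close> to \<open>1\<close> is translated back by
  \<open>t\<close>, the piece from \<open>0\<close> to \<open>t\<close> is translated forward by
  \<open>1 - t\<close>, and the two images tile the unit interval again.\<close>

lemma has_bochner_integral_periodic_shift:
  fixes f :: "real \<Rightarrow> 'a :: {banach, second_countable_topology}"
  assumes per: "\<And>x. f (x + 1) = f x"
    and int: "integrable unit_interval f"
  shows "has_bochner_integral unit_interval (\<lambda>x. f (x + s)) (integral\<^sup>L unit_interval f)"
proof -
  define t where "t = frac s"
  have t: "0 \<le> t" "t < 1" by (auto simp: t_def frac_lt_1)
  have shift: "f (x + s) = f (x + t)" for x
    using periodic_add_int[of f "x + t" "\<lfloor>s\<rfloor>", OF per] by (simp add: t_def frac_def algebra_simps)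
  have F: "set_integrable lborel {0..1} f"
    using int by (simp add: integrable_unit_interval_iff)
  have F1: "set_integrable lborel {0<..t} f" "set_integrable lborel {t..1} f"
    using t by (auto intro: set_integrable_subset[OF F])
  have A: "has_bochner_integral lborel (\<lambda>x. indicator {t..1} x *\<^sub>R f x) (LINT x:{t..1}|lborel. f x)"
    using F1 by (simp add: has_bochner_integral_iff set_integrable_def set_lebesgue_integral_def)
  have B: "has_bochner_integral lborel (\<lambda>x. indicator {0<..t} x *\<^sub>R f x) (LINT x:{0<..t}|lborel. f x)"
    using F1 by (simp add: has_bochner_integral_iff set_integrable_def set_lebesgue_integral_def)
  have A': "has_bochner_integral lborel (\<lambda>x. indicator {0..1-t} x *\<^sub>R f (x + t)) (LINT x:{t..1}|lborel. f x)"
  proof -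
    have "has_bochner_integral lborel (\<lambda>x. indicator {t..1} (t + 1 * x) *\<^sub>R f (t + 1 * x))
        ((LINT x:{t..1}|lborel. f x) /\<^sub>R \<bar>1\<bar>)"
      using A by (subst (asm) lborel_has_bochner_integral_real_affine_iff[where c = 1 and t = t]) auto
    moreover have "indicator {t..1} (t + 1 * x) *\<^sub>R f (t + 1 * x) = indicator {0..1-t} x *\<^sub>R f (x + t)" for x
      by (auto simp: indicator_def add_ac)
    ultimately show ?thesis by simp
  qed
  have B': "has_bochner_integral lborel (\<lambda>x. indicator {1-t<..1} x *\<^sub>R f (x + t)) (LINT x:{0<..t}|lborel. f x)"
  proof -
    have "has_bochner_integral lborel (\<lambda>x. indicator {0<..t} ((t-1) + 1 * x) *\<^sub>R f ((t-1) + 1 * x))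
        ((LINT x:{0<..t}|lborel. f x) /\<^sub>R \<bar>1\<bar>)"
      using B by (subst (asm) lborel_has_bochner_integral_real_affine_iff[where c = 1 and t = "t-1"]) auto
    moreover have "indicator {0<..t} ((t-1) + 1 * x) *\<^sub>R f ((t-1) + 1 * x) = indicator {1-t<..1} x *\<^sub>R f (x + t)" for x
      using per[of "t - 1 + x"] by (auto simp: indicator_def add_ac)
    ultimately show ?thesis by simp
  qed
  have sum: "(LINT x:{t..1}|lborel. f x) + (LINT x:{0<..t}|lborel. f x) = (LINT x:{0..1}|lborel. f x)"
  proof -
    \<comment> \<open>The two pieces can overlap only at \<open>t\<close> and can miss only
      \<open>0\<close>.\<close>
    have ae: "AE x in lborel. x \<notin> {0, t}"
      by (intro AE_not_in countable_imp_null_set_lborel) auto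
    have 1: "AE x in lborel. \<not> (x \<in> {t..1} \<and> x \<in> {0<..t})"
      using ae by eventually_elim auto
    have 2: "AE x in lborel. x \<in> {t..1} \<union> {0<..t} \<longleftrightarrow> x \<in> {0..1}"
      using ae by eventually_elim (use t in auto)
    have "set_integrable lborel ({t..1} \<union> {0<..t}) f"
      by (intro set_integrable_Un F1) auto
    hence "(LINT x:{0..1}|lborel. f x) = (LINT x:{t..1} \<union> {0<..t}|lborel. f x)"
      using F 2 by (intro set_integral_cong_set)
        (auto simp: set_integrable_def set_borel_measurable_def dest: borel_measurable_integrable)
    also have "\<dots> = (LINT x:{t..1}|lborel. f x) + (LINT x:{0<..t}|lborel. f x)"
      by (rule set_integral_Un_AE[OF 1]) (use F1 in auto)
    finally show ?thesis by simp
  qed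
  have "indicator {0..1-t} x *\<^sub>R f (x + t) + indicator {1-t<..1} x *\<^sub>R f (x + t)
      = indicator {0..1} x *\<^sub>R f (x + t)" for x
    using t by (simp add: indicator_def)
  hence "has_bochner_integral lborel (\<lambda>x. indicator {0..1} x *\<^sub>R f (x + t)) (LINT x:{0..1}|lborel. f x)"
    using has_bochner_integral_add[OF A' B'] by (simp add: sum)
  thus ?thesis
    by (simp add: has_bochner_integral_iff shift integrable_unit_interval_iff set_integrable_def
        set_integral_eq_unit_interval[symmetric] set_lebesgue_integral_def)
qed

section \<open>Integrability of negative powers of the sine\<close>

lemma sin_ge_half:
  fixes y :: real
  assumes "0 \<le> y" "y \<le> pi / 2"
  shows "y / 2 \<le> sin y"
proof -
  have "\<bar>sin y - (\<Sum>m<3. sin_coeff m * y ^ m)\<bar> \<le> inverse (fact 3) * \<bar>y\<bar> ^ 3"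
    by (rule Maclaurin_sin_bound)
  hence "\<bar>sin y - y\<bar> \<le> y ^ 3 / 6"
    using assms by (simp add: eval_nat_numeral sin_coeff_def)
  hence "y - y ^ 3 / 6 \<le> sin y"
    by linarith
  moreover have "y ^ 3 \<le> 3 * y"
  proof -
    \<comment> \<open>The bound 17/10 lies above pi/2, while its square 2.89 is still below
      3.\<close>
    have "y \<le> 17/10" using assms pi_approx by (simp add: field_simps)
    hence "y * y \<le> (17/10) * (17/10)" using assms by (intro mult_mono) auto
    hence "y * (y * y) \<le> y * 3" using assms by (intro mult_left_mono) auto
    thus ?thesis by (simp add: power3_eq_cube mult_ac)
  qed
  ultimately show ?thesis by linarith
qed

text \<open>On the left half the crude slope 1/2 of \<open>sin_ge_half\<close> is enough because pi
  is at least 2; the reflection of \<open>x\<close> to \<open>1 - x\<close> gives the right half.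
  The bound compares the zeros of the sine at both endpoints with linear ones.\<close>

lemma sin_pi_ge_min:
  assumes "0 \<le> x" "x \<le> 1"
  shows "min x (1 - x) \<le> sin (pi * x)"
proof -
  have *: "x \<le> sin (pi * x)" if "0 \<le> x" "x \<le> 1/2" for x
  proof -
    have "pi * x / 2 \<le> sin (pi * x)"
      using that by (intro sin_ge_half) auto
    moreover have "2 * x \<le> pi * x"
      using that pi_ge_two by (intro mult_right_mono) auto
    ultimately show ?thesis by linarith
  qed
  show ?thesis
  proof (cases "x \<le> 1/2")
    case True thus ?thesis using *[of x] assms by auto
  next
    case False
    have "sin (pi * (1 - x)) = sin (pi * x)"
      by (simp add: right_diff_distrib sin_diff)
    thus ?thesis using *[of "1 - x"] assms False by auto
  qed
qed

lemma integrable_inverse_sqrt: "integrable unit_interval (\<lambda>x. x powr (-1/2))"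
proof -
  have "(\<lambda>x::real. x powr (-1/2)) absolutely_integrable_on {0..1}"
    by (intro nonnegative_absolutely_integrable_1 integrable_on_powr_from_0) auto
  thus ?thesis
    unfolding integrable_unit_interval_iff set_integrable_def
    by (subst (asm) integrable_completion) auto
qed

text \<open>By \<open>sin_pi_ge_min\<close> the singularities at \<open>0\<close> and
  \<open>1\<close> are no worse than inverse square roots of the distance to the endpoint. The
  exponent -1/2 is the one produced by cubing \<open>log_majorant\<close>.\<close>

lemma integrable_abs_sin_powr:
  "integrable unit_interval (\<lambda>x. \<bar>sin (pi * x)\<bar> powr (-1/2))"
proof -
  have I2: "integrable unit_interval (\<lambda>x. (1 - x) powr (-1/2))"
  proof -
    have "integrable lborel (\<lambda>x::real. indicator {0..1} (1 + (-1) * x) *\<^sub>R (1 + (-1) * x) powr (-1/2))"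
      using integrable_inverse_sqrt unfolding integrable_unit_interval_iff set_integrable_def
      by (subst lborel_integrable_real_affine_iff) auto
    moreover have "indicator {0..1} (1 + (-1) * x) = (indicator {0..1} x :: real)" for x :: real
      by (auto simp: indicator_def)
    ultimately show ?thesis
      unfolding integrable_unit_interval_iff set_integrable_def by simp
  qed
  show ?thesis
  proof (rule Bochner_Integration.integrable_bound)
    show "integrable unit_interval (\<lambda>x. x powr (-1/2) + (1 - x) powr (-1/2))"
      by (intro Bochner_Integration.integrable_add integrable_inverse_sqrt I2)
    have "AE x in unit_interval. x \<notin> {0, 1}"
      by (rule AE_unit_interval_not_in_countable) auto
    thus "AE x in unit_interval. norm (\<bar>sin (pi * x)\<bar> powr (-1/2)) \<le> norm (x powr (-1/2) + (1 - x) powr (-1/2))"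
      using AE_space
    proof eventually_elim
      case (elim x)
      hence x: "0 < x" "x < 1" by auto
      have "\<bar>sin (pi * x)\<bar> powr (-1/2) \<le> min x (1 - x) powr (-1/2)"
        using sin_pi_ge_min[of x] x by (intro powr_mono2') auto
      also have "\<dots> \<le> x powr (-1/2) + (1 - x) powr (-1/2)"
        by (auto simp: min_def)
      finally show ?case by simp
    qed
  qed (intro measurable_unit_interval, measurable)
qed

section \<open>The logarithm of the distance to 1 on the unit circle\<close>

definition ucirc :: "real \<Rightarrow> complex" where
  "ucirc x = cis (2 * pi * x)"

definition log_dist :: "real \<Rightarrow> real" where
  "log_dist x = ln (cmod (1 - ucirc x))"

text \<open>The periodised first Bernoulli polynomial. Its value at integers is -1/2 instead of the
  symmetric 0, which changes no integral.\<close>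

definition sawtooth :: "real \<Rightarrow> real" where
  "sawtooth x = frac x - 1 / 2"

lemma norm_ucirc [simp]: "cmod (ucirc x) = 1"
  by (simp add: ucirc_def)

lemma ucirc_add_1 [simp]: "ucirc (x + 1) = ucirc x"
  by (simp add: ucirc_def distrib_left flip: cis_mult)

lemma log_dist_add_1 [simp]: "log_dist (x + 1) = log_dist x"
  by (simp add: log_dist_def)

lemma sawtooth_add_1 [simp]: "sawtooth (x + 1) = sawtooth x"
  by (simp add: sawtooth_def frac_def)

lemma abs_sawtooth_le: "\<bar>sawtooth x\<bar> \<le> 1"
  using frac_lt_1[of x] frac_ge_0[of x] unfolding sawtooth_def by linarith

lemma continuous_on_ucirc [continuous_intros]:
  "continuous_on A f \<Longrightarrow> continuous_on A (\<lambda>x. ucirc (f x))"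
  unfolding ucirc_def by (intro continuous_intros)

lemma borel_measurable_ucirc [measurable]: "ucirc \<in> borel_measurable borel"
  by (intro borel_measurable_continuous_onI continuous_intros)

lemma borel_measurable_log_dist [measurable]: "log_dist \<in> borel_measurable borel"
  unfolding log_dist_def by measurable

lemma borel_measurable_sawtooth [measurable]: "sawtooth \<in> borel_measurable borel"
  unfolding sawtooth_def frac_def by measurable

text \<open>Half-angle factorisation: extracting half of the angle leaves the sine times a factor
  \<open>-2 i\<close>, and \<open>-i\<close> is absorbed into the shift by 1/2. Both the modulus and
  the argument can be read off.\<close>

lemma one_minus_ucirc:
  "1 - ucirc x = of_real (2 * sin (pi * x)) * cis (pi * (x - 1 / 2))"
proof -
  have "cos (2 * (pi * x)) = 1 - 2 * sin (pi * x) ^ 2" "sin (2 * (pi * x)) = 2 * sin (pi * x) * cos (pi * x)"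
    by (simp_all add: cos_double_sin sin_double)
  thus ?thesis
    by (simp add: complex_eq_iff ucirc_def right_diff_distrib cos_diff sin_diff power2_eq_square mult.assoc)
qed

lemma norm_one_minus_ucirc: "cmod (1 - ucirc x) = 2 * \<bar>sin (pi * x)\<bar>"
  by (simp add: one_minus_ucirc norm_mult)

lemma sin_pi_eq_0_iff: "sin (pi * x) = 0 \<longleftrightarrow> x \<in> \<int>" for x :: real
  by (auto simp: sin_zero_iff_int2 mult.commute Ints_def)

lemma ucirc_eq_1_iff [simp]: "ucirc x = 1 \<longleftrightarrow> x \<in> \<int>"
  using norm_one_minus_ucirc[of x] sin_pi_eq_0_iff[of x] by auto

lemma ucirc_frac: "ucirc (frac x) = ucirc x"
  using periodic_add_int[of ucirc "frac x" "\<lfloor>x\<rfloor>"] by (simp add: frac_def)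

text \<open>For \<open>y\<close> strictly between 0 and 1 the sine in \<open>one_minus_ucirc\<close>
  is positive, and the angle there already lies in the principal range, so it is the argument.
  Periodicity gives the general case.\<close>

lemma Im_Ln_one_minus_ucirc:
  assumes "x \<notin> \<int>"
  shows "Im (Ln (1 - ucirc x)) = pi * sawtooth x"
proof -
  define y where "y = frac x"
  have y: "0 < y" "y < 1"
    using assms by (auto simp: y_def frac_lt_1 frac_gt_0_iff)
  have "Arg (1 - ucirc y) = pi * (y - 1 / 2)"
  proof (rule Arg_unique'[of "2 * sin (pi * y)"])
    show "0 < 2 * sin (pi * y)"
      using y by (simp add: sin_gt_zero)
    have "pi * (-1) < pi * (y - 1 / 2)" "pi * (y - 1 / 2) < pi * 1"
      using y by (intro mult_strict_left_mono; simp)+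
    thus "pi * (y - 1 / 2) \<in> {- pi<..pi}" by simp
    show "1 - ucirc y = rcis (2 * sin (pi * y)) (pi * (y - 1 / 2))"
      by (simp add: one_minus_ucirc rcis_def)
  qed
  thus ?thesis
    using assms by (simp add: y_def ucirc_frac sawtooth_def Arg_eq_Im_Ln)
qed

lemma Re_Ln_one_minus_ucirc: "x \<notin> \<int> \<Longrightarrow> Re (Ln (1 - ucirc x)) = log_dist x"
  by (simp add: log_dist_def)

section \<open>A majorant of the logarithm, uniform in the radius\<close>

definition log_majorant :: "real \<Rightarrow> real" where
  "log_majorant x = 10 * \<bar>sin (pi * x)\<bar> powr (-1/6)"

text \<open>The bound does not depend on \<open>r\<close>, so it can dominate the limit of the
  radius to 1. Its source is that \<open>1 - r e x\<close> has modulus at least \<open>s\<close>,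
  together with the growth of the logarithm below any negative power. The power -1/6 is chosen so
  that the cube stays integrable, and 10 = 6 + 4 collects the real and the imaginary part.\<close>

lemma norm_Ln_one_minus_le:
  assumes r: "0 \<le> r" "r \<le> 1" and x: "x \<notin> \<int>"
  shows "cmod (Ln (1 - of_real r * ucirc x)) \<le> log_majorant x"
proof -
  define z where "z = 1 - of_real r * ucirc x"
  define s where "s = \<bar>sin (pi * x)\<bar>"
  have s: "0 < s" "s \<le> 1"
    using x by (auto simp: s_def sin_pi_eq_0_iff)
  have z2: "cmod z \<le> 2"
    using norm_triangle_ineq4[of 1 "of_real r * ucirc x"] r by (simp add: z_def norm_mult)
  have "1 - r \<le> cmod z"
    using norm_triangle_ineq2[of 1 "of_real r * ucirc x"] r by (simp add: z_def norm_mult)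
  moreover have "2 * s \<le> cmod z + (1 - r)"
  proof -
    have "1 - ucirc x = z - of_real (1 - r) * ucirc x"
      by (simp add: z_def algebra_simps)
    hence "cmod (1 - ucirc x) \<le> cmod z + cmod (of_real (1 - r) * ucirc x)"
      by (metis norm_triangle_ineq4)
    also have "cmod (of_real (1 - r) * ucirc x) = 1 - r"
      using r by (simp only: norm_mult norm_of_real norm_ucirc) auto
    finally show ?thesis by (simp add: norm_one_minus_ucirc s_def)
  qed
  \<comment> \<open>Both inequalities combine to \<open>2 * s \<le> 2 * cmod z\<close>.\<close>
  ultimately have sz: "s \<le> cmod z" by linarith
  hence z0: "z \<noteq> 0" using s by auto
  \<comment> \<open>This lets the power absorb additive constants.\<close>
  have p1: "1 \<le> s powr (-1/6)"
    using powr_mono2'[of "-1/6" s 1] s by simp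
  have "\<bar>ln (cmod z)\<bar> \<le> 6 * s powr (-1/6)"
  proof (cases "cmod z \<ge> 1")
    case True
    have "ln (cmod z) \<le> cmod z - 1" using z0 by (intro ln_le_minus_one) auto
    thus ?thesis using True z2 p1 by auto
  next
    case False
    have "- ln (cmod z) \<le> - ln s" using sz s z0 by (subst neg_le_iff_le, subst ln_le_cancel_iff) auto
    also have "\<dots> = 6 * ln (s powr (-1/6))" using s by (simp add: ln_powr)
    also have "\<dots> \<le> 6 * s powr (-1/6)"
      using ln_le_minus_one[of "s powr (-1/6)"] s by simp
    finally show ?thesis using False z0 by (simp add: abs_if)
  qed
  moreover have "\<bar>Im (Ln z)\<bar> \<le> 4"
    using mpi_less_Im_Ln[OF z0] Im_Ln_le_pi[OF z0] pi_less_4 by linarith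
  ultimately have "cmod (Ln z) \<le> 6 * s powr (-1/6) + 4"
    using cmod_le[of "Ln z"] z0 by simp
  also have "\<dots> \<le> 10 * s powr (-1/6)" using p1 by simp
  finally show ?thesis by (simp add: log_majorant_def s_def z_def)
qed

lemma log_majorant_add_1 [simp]: "log_majorant (x + 1) = log_majorant x"
  by (simp add: log_majorant_def distrib_left sin_add)

lemma log_majorant_nonneg [simp]: "0 \<le> log_majorant x"
  by (simp add: log_majorant_def)

lemma borel_measurable_log_majorant [measurable]: "log_majorant \<in> borel_measurable borel"
  unfolding log_majorant_def by measurable

lemma integrable_log_majorant_cubed:
  "integrable unit_interval (\<lambda>x. log_majorant (x + s) ^ 3)"
proof -
  have eq: "log_majorant x ^ 3 = 1000 * \<bar>sin (pi * x)\<bar> powr (-1/2)" for x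
    by (cases "sin (pi * x) = 0") (simp_all add: log_majorant_def power_mult_distrib powr_power)
  have "integrable unit_interval (\<lambda>x. log_majorant x ^ 3)"
    unfolding eq by (intro integrable_mult_right integrable_abs_sin_powr)
  from has_bochner_integral_periodic_shift[OF _ this, of s] show ?thesis
    by (simp add: has_bochner_integral_iff)
qed

lemma integrable_log_majorant:
  "integrable unit_interval (\<lambda>x. log_majorant (x + s))"
proof (rule Bochner_Integration.integrable_bound)
  show "integrable unit_interval (\<lambda>x. 1 + log_majorant (x + s) ^ 3)"
    by (intro Bochner_Integration.integrable_add integrable_log_majorant_cubed) auto
  have "a \<le> 1 + a ^ 3" if "0 \<le> a" for a :: real
  proof (cases "a \<le> 1")
    case False
    hence "a ^ 1 \<le> a ^ 3" by (intro power_increasing) auto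
    thus ?thesis by simp
  qed (use that in \<open>simp add: add_increasing2\<close>)
  thus "AE x in unit_interval. norm (log_majorant (x + s)) \<le> norm (1 + log_majorant (x + s) ^ 3)"
    by (intro always_eventually allI) (simp add: abs_of_nonneg)
qed (intro measurable_unit_interval, measurable)

text \<open>Cauchy's formula at the centre: along the circle \<open>dz / z\<close> is
  \<open>2 pi i dx\<close>, so the contour integral is an average over \<open>x\<close>. Continuity
  of the integrand turns the gauge integral into a Lebesgue integral.\<close>

lemma mean_value_circle:
  assumes g: "g holomorphic_on cball 0 r" and r: "0 < r"
  shows "has_bochner_integral unit_interval (\<lambda>x. g (of_real r * ucirc x)) (g 0)"
proof -
  have circ: "circlepath 0 r x = of_real r * ucirc x" for x
    by (simp add: circlepath ucirc_def cis_conv_exp mult_ac)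
  have "((\<lambda>u. g u / (u - 0)) has_contour_integral (2 * of_real pi * \<i> * g 0)) (circlepath 0 r)"
    by (rule Cauchy_integral_circlepath_simple) (use g r in auto)
  hence "((\<lambda>x. 2 * of_real pi * \<i> * g (of_real r * ucirc x)) has_integral 2 * of_real pi * \<i> * g 0) {0..1}"
    unfolding has_contour_integral vector_derivative_circlepath circ
    using r by (simp add: ucirc_def cis_conv_exp mult_ac)
  from has_integral_mult_right[OF this, of "1 / (2 * of_real pi * \<i>)"]
  have hk: "((\<lambda>x. g (of_real r * ucirc x)) has_integral g 0) {0..1}"
    by simp
  have "continuous_on {0..1} (\<lambda>x. g (of_real r * ucirc x))"
    by (rule continuous_on_compose2[OF holomorphic_on_imp_continuous_on[OF g]])
      (use r in \<open>auto intro!: continuous_intros simp: norm_mult\<close>)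
  hence int: "set_integrable lborel {0..1} (\<lambda>x. g (of_real r * ucirc x))"
    by (rule borel_integrable_atLeastAtMost')
  hence "(LINT x:{0..1}|lborel. g (of_real r * ucirc x)) = integral {0..1} (\<lambda>x. g (of_real r * ucirc x))"
    by (rule set_borel_integral_eq_integral)
  with hk int show ?thesis
    by (simp add: has_bochner_integral_iff integrable_unit_interval_iff
        set_integral_eq_unit_interval integral_unique)
qed

section \<open>Integrals against the logarithm\<close>

text \<open>Keeps the argument of \<open>Ln\<close> off the branch cut on the closed disc without
  the point 1, as needed both for holomorphy inside and for radial limits.\<close>

lemma one_minus_notin_nonpos_Reals:
  assumes "cmod z \<le> 1" "z \<noteq> 1"
  shows "1 - z \<notin> \<real>\<^sub>\<le>\<^sub>0"
proof
  assume "1 - z \<in> \<real>\<^sub>\<le>\<^sub>0"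
  hence "1 \<le> Re z" "Im z = 0" by (auto simp: complex_nonpos_Reals_iff)
  moreover have "Re z \<le> 1" using complex_Re_le_cmod[of z] assms by linarith
  ultimately have "z = 1" by (simp add: complex_eq_iff)
  with assms show False by simp
qed

text \<open>Every term is at most the largest one, whose cube is among the summands. With it the
  cube of a sum of majorants is controlled by the integrable individual cubes.\<close>

lemma sum_cubed_le:
  fixes a :: "'b \<Rightarrow> real"
  assumes "finite A" "\<And>j. j \<in> A \<Longrightarrow> 0 \<le> a j"
  shows "(\<Sum>j\<in>A. a j) ^ 3 \<le> real (card A) ^ 3 * (\<Sum>j\<in>A. a j ^ 3)"
proof (cases "A = {}")
  case False
  have "Max (a ` A) \<in> a ` A" using assms(1) False by (intro Max_in) auto
  then obtain k where "k \<in> A" "a k = Max (a ` A)" by auto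
  hence k: "k \<in> A" "\<And>j. j \<in> A \<Longrightarrow> a j \<le> a k" using assms(1) by auto
  have "(\<Sum>j\<in>A. a j) ^ 3 \<le> (real (card A) * a k) ^ 3"
    using k assms by (intro power_mono sum_bounded_above sum_nonneg) auto
  also have "\<dots> = real (card A) ^ 3 * a k ^ 3" by (simp add: power_mult_distrib)
  also have "\<dots> \<le> real (card A) ^ 3 * (\<Sum>j\<in>A. a j ^ 3)"
    using k assms by (intro mult_left_mono member_le_sum[of k A "\<lambda>j. a j ^ 3"]) auto
  finally show ?thesis .
qed simp

section \<open>Radial limits and the vanishing mean of the cubed logarithm\<close>

definition radius :: "nat \<Rightarrow> real" where
  "radius m = 1 - 1 / real (m + 2)"

lemma radius: "0 < radius m" "radius m < 1"
  by (simp_all add: radius_def)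

lemma radius_tendsto: "radius \<longlonglongrightarrow> 1"
proof -
  have "(\<lambda>m. 1 - 1 / real (m + 2)) \<longlonglongrightarrow> 1 - 0"
    by (intro tendsto_intros LIMSEQ_ignore_initial_segment[of "\<lambda>n. 1 / real n"] lim_1_over_n)
  thus ?thesis by (simp add: radius_def [abs_def])
qed

lemma tendsto_Ln_radius:
  assumes "x \<notin> \<int>"
  shows "(\<lambda>m. Ln (1 - of_real (radius m) * ucirc x)) \<longlonglongrightarrow> Ln (1 - ucirc x)"
proof -
  have "(\<lambda>m. Ln (1 - of_real (radius m) * ucirc x)) \<longlonglongrightarrow> Ln (1 - of_real 1 * ucirc x)"
    using assms
    by (intro tendsto_Ln tendsto_intros radius_tendsto one_minus_notin_nonpos_Reals) auto
  thus ?thesis by simp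
qed

lemma ucirc_add: "ucirc (x + y) = ucirc x * ucirc y"
  by (simp add: ucirc_def cis_mult distrib_left)

text \<open>On each circle of radius below 1 the mean value property applies to a function that
  vanishes at the centre, since \<open>Ln 1 = 0\<close>. Dominated convergence with the majorant
  \<open>w\<close> carries the zero mean, and integrability, to the unit circle.\<close>

lemma has_bochner_integral_sum_Ln_cubed:
  fixes \<alpha> :: "'b \<Rightarrow> real"
  assumes A: "finite A"
  shows "has_bochner_integral unit_interval (\<lambda>x. (\<Sum>j\<in>A. Ln (1 - ucirc (x - \<alpha> j))) ^ 3) 0"
proof -
  define s where "s m x = (\<Sum>j\<in>A. Ln (1 - of_real (radius m) * ucirc (x - \<alpha> j))) ^ 3" for m x
  define w where "w x = real (card A) ^ 3 * (\<Sum>j\<in>A. log_majorant (x - \<alpha> j) ^ 3)" for x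
  have int_s: "has_bochner_integral unit_interval (s m) 0" for m
  proof -
    define g where "g z = (\<Sum>j\<in>A. Ln (1 - z * ucirc (- \<alpha> j))) ^ 3" for z
    have "1 - z * ucirc (- \<alpha> j) \<notin> \<real>\<^sub>\<le>\<^sub>0" if "z \<in> cball 0 (radius m)" for z j
    proof (rule one_minus_notin_nonpos_Reals)
      have *: "cmod (z * ucirc (- \<alpha> j)) < 1"
        using that radius(2)[of m] by (simp add: norm_mult)
      thus "cmod (z * ucirc (- \<alpha> j)) \<le> 1" by simp
      show "z * ucirc (- \<alpha> j) \<noteq> 1" using * by auto
    qed
    hence "g holomorphic_on cball 0 (radius m)"
      unfolding g_def by (intro holomorphic_intros) auto
    from mean_value_circle[OF this radius(1)]
    have "has_bochner_integral unit_interval (\<lambda>x. g (of_real (radius m) * ucirc x)) (g 0)" .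
    moreover have "g (of_real (radius m) * ucirc x) = s m x" for x
      using ucirc_add[of x "- \<alpha> j" for j] by (simp add: g_def s_def mult.assoc)
    moreover have "g 0 = 0" by (simp add: g_def)
    ultimately show ?thesis by simp
  qed
  have ae: "AE x in unit_interval. \<forall>j\<in>A. x - \<alpha> j \<notin> \<int>"
    using AE_unit_interval_shift_not_Ints[of "- \<alpha> j" for j] A
    by (intro AE_finite_allI) auto
  have meas: "(\<lambda>x. (\<Sum>j\<in>A. Ln (1 - ucirc (x - \<alpha> j))) ^ 3) \<in> borel_measurable unit_interval"
    by (intro measurable_unit_interval) measurable
  have meas_s: "s m \<in> borel_measurable unit_interval" for m
    using int_s by (rule borel_measurable_has_bochner_integral)
  have int_w: "integrable unit_interval w"
    unfolding w_def using integrable_log_majorant_cubed[of "- \<alpha> j" for j]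
    by (intro integrable_mult_right Bochner_Integration.integrable_sum) simp
  have lim: "AE x in unit_interval. (\<lambda>m. s m x) \<longlonglongrightarrow> (\<Sum>j\<in>A. Ln (1 - ucirc (x - \<alpha> j))) ^ 3"
    using ae by eventually_elim (auto simp: s_def intro!: tendsto_intros tendsto_Ln_radius)
  have bound: "AE x in unit_interval. norm (s m x) \<le> w x" for m
    using ae
  proof eventually_elim
    case (elim x)
    have "norm (s m x) = cmod (\<Sum>j\<in>A. Ln (1 - of_real (radius m) * ucirc (x - \<alpha> j))) ^ 3"
      by (simp add: s_def norm_power)
    also have "\<dots> \<le> (\<Sum>j\<in>A. log_majorant (x - \<alpha> j)) ^ 3"
      using elim radius[of m]
      by (intro power_mono sum_norm_le norm_Ln_one_minus_le) auto
    also have "\<dots> \<le> w x"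
      unfolding w_def by (intro sum_cubed_le A) auto
    finally show ?case .
  qed
  have "(\<lambda>m. integral\<^sup>L unit_interval (s m)) \<longlonglongrightarrow>
      integral\<^sup>L unit_interval (\<lambda>x. (\<Sum>j\<in>A. Ln (1 - ucirc (x - \<alpha> j))) ^ 3)"
    by (rule integral_dominated_convergence[OF meas meas_s int_w lim bound])
  moreover have "integral\<^sup>L unit_interval (s m) = 0" for m
    using int_s by (rule has_bochner_integral_integral_eq)
  ultimately have "integral\<^sup>L unit_interval (\<lambda>x. (\<Sum>j\<in>A. Ln (1 - ucirc (x - \<alpha> j))) ^ 3) = 0"
    by (simp add: LIMSEQ_const_iff)
  moreover have "integrable unit_interval (\<lambda>x. (\<Sum>j\<in>A. Ln (1 - ucirc (x - \<alpha> j))) ^ 3)"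
    by (rule integrable_dominated_convergence[OF meas meas_s int_w lim bound])
  ultimately show ?thesis by (simp add: has_bochner_integral_iff)
qed

lemma abs_log_dist_le: "x \<notin> \<int> \<Longrightarrow> \<bar>log_dist x\<bar> \<le> log_majorant x"
  using norm_Ln_one_minus_le[of 1 x] abs_Re_le_cmod[of "Ln (1 - ucirc x)"]
  by (simp add: Re_Ln_one_minus_ucirc del: Re_Ln)

lemma integrable_log_dist_mult:
  fixes h :: "real \<Rightarrow> real"
  assumes [measurable]: "h \<in> borel_measurable borel" and h: "\<And>x. \<bar>h x\<bar> \<le> C"
  shows "integrable unit_interval (\<lambda>x. log_dist (x + s) * h x)"
proof (rule Bochner_Integration.integrable_bound)
  show "integrable unit_interval (\<lambda>x. log_majorant (x + s) * C)"
    by (intro integrable_mult_left integrable_log_majorant)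
  have C: "0 \<le> C" using h[of 0] by linarith
  show "AE x in unit_interval. norm (log_dist (x + s) * h x) \<le> norm (log_majorant (x + s) * C)"
    using AE_unit_interval_shift_not_Ints[of s]
    by eventually_elim (use C h in \<open>auto simp: abs_mult intro!: mult_mono abs_log_dist_le\<close>)
qed (intro measurable_unit_interval, measurable)

section \<open>Abel-regularised Fourier series of the logarithm\<close>

lemma Re_Ln_one_minus_radius_sums:
  assumes r: "0 < r" "r < 1"
  shows "(\<lambda>N. r ^ Suc N * cos (2 * pi * real (Suc N) * x) / real (Suc N)) sums
    (- Re (Ln (1 - of_real r * ucirc x)))"
proof -
  define z where "z = of_real r * ucirc x"
  have "cmod (- z) < 1" using r by (simp add: z_def norm_mult)
  from Ln_series'[OF this] have "(\<lambda>n. - (z ^ n) / of_nat n) sums Ln (1 - z)" by simp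
  hence "(\<lambda>n. - (- (z ^ n) / of_nat n)) sums (- Ln (1 - z))" by (rule sums_minus)
  hence "(\<lambda>n. z ^ n / of_nat n) sums (- Ln (1 - z))" by simp
  \<comment> \<open>The dropped term at index 0 is \<open>1 / 0\<close>, which is 0 by
    convention.\<close>
  hence "(\<lambda>N. z ^ Suc N / of_nat (Suc N)) sums (- Ln (1 - z))"
    by (subst sums_Suc_iff) simp
  hence "(\<lambda>N. Re (z ^ Suc N / of_nat (Suc N))) sums Re (- Ln (1 - z))"
    by (rule sums_Re)
  moreover have "Re (z ^ Suc N / of_nat (Suc N)) = r ^ Suc N * cos (2 * pi * real (Suc N) * x) / real (Suc N)" for N
  proof -
    have *: "z ^ Suc N = of_real (r ^ Suc N) * cis (real (Suc N) * (2 * pi * x))"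
      unfolding z_def ucirc_def power_mult_distrib Complex.DeMoivre by simp
    have "Re (of_real a * cis b) = a * cos b" for a b by simp
    hence "Re (z ^ Suc N) = r ^ Suc N * cos (real (Suc N) * (2 * pi * x))" unfolding * .
    thus ?thesis unfolding Re_divide_of_nat by (simp only: mult_ac)
  qed
  ultimately show ?thesis by (simp add: z_def)
qed

text \<open>The Fourier series of \<open>log_dist\<close> is not absolutely convergent, so it is
  integrated termwise at radius below 1 and both sides are then taken to the limit. The summability
  hypothesis concerns only the products with the coefficients of \<open>h\<close>.\<close>

lemma integral_log_dist_mult:
  fixes h :: "real \<Rightarrow> real" and c :: "nat \<Rightarrow> real"
  assumes [measurable]: "h \<in> borel_measurable borel" and h: "\<And>x. \<bar>h x\<bar> \<le> C"
    and c: "\<And>N. (LINT x|unit_interval. cos (2 * pi * real (Suc N) * x) * h x) = c N"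
    and summ: "summable (\<lambda>N. \<bar>c N\<bar> / real (Suc N))"
  shows "(LINT x|unit_interval. log_dist x * h x) = - (\<Sum>N. c N / real (Suc N))"
proof -
  define R where "R m x = Re (Ln (1 - of_real (radius m) * ucirc x)) * h x" for m x
  have C: "0 \<le> C" using h[of 0] by linarith
  have coscoef: "\<bar>cos (2 * pi * real (Suc N) * x) * h x\<bar> \<le> C" for N x
    using mult_mono[of "\<bar>cos (2 * pi * real (Suc N) * x)\<bar>" 1 "\<bar>h x\<bar>" C] h[of x] C by (simp add: abs_mult)
  \<comment> \<open>For fixed radius the terms decay geometrically, which justifies exchanging sum
    and integral.\<close>
  have 1: "integral\<^sup>L unit_interval (R m) = - (\<Sum>N. radius m ^ Suc N * (c N / real (Suc N)))" for m
  proof -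
    define r where "r = radius m"
    have r: "0 < r" "r < 1" by (simp_all add: r_def radius)
    define f where "f N x = r ^ Suc N / real (Suc N) * (cos (2 * pi * real (Suc N) * x) * h x)" for N x
    have fb: "norm (f N x) \<le> C * r ^ Suc N" for N x
    proof -
      have "norm (f N x) = r ^ Suc N / real (Suc N) * \<bar>cos (2 * pi * real (Suc N) * x) * h x\<bar>"
        using r by (simp add: f_def abs_mult)
      also have "\<dots> \<le> r ^ Suc N / 1 * C"
        using r coscoef by (intro mult_mono divide_left_mono) auto
      finally show ?thesis by (simp add: mult_ac)
    qed
    have fm: "f N \<in> borel_measurable borel" for N
      unfolding f_def by measurable
    have fi: "integrable unit_interval (f N)" for N
      by (rule integrable_unit_interval_bounded[OF fm fb])
    have geo: "summable (\<lambda>N. C * r ^ Suc N)"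
      using r by (intro summable_mult) (simp add: summable_geometric summable_mult)
    have "(\<lambda>N. integral\<^sup>L unit_interval (f N)) sums (LINT x|unit_interval. (\<Sum>N. f N x))"
    proof (rule sums_integral[OF fi])
      show "AE x in unit_interval. summable (\<lambda>N. norm (f N x))"
        by (intro always_eventually allI summable_comparison_test'[OF geo]) (use fb in auto)
      show "summable (\<lambda>N. LINT x|unit_interval. norm (f N x))"
      proof (rule summable_comparison_test'[OF summable_mult2[OF geo, of "measure unit_interval {0..1}"]])
        fix N
        have "(LINT x|unit_interval. norm (f N x)) \<le> (LINT x|unit_interval. C * r ^ Suc N)"
          by (intro integral_mono fb integrable_norm fi) auto
        thus "norm (LINT x|unit_interval. norm (f N x)) \<le> C * r ^ Suc N * measure unit_interval {0..1}"
          by (simp add: mult_ac)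
      qed
    qed
    moreover have "(\<Sum>N. f N x) = - R m x" for x
    proof -
      have "(\<lambda>N. r ^ Suc N * cos (2 * pi * real (Suc N) * x) / real (Suc N) * h x) sums
          (- Re (Ln (1 - of_real r * ucirc x)) * h x)"
        by (intro sums_mult2 Re_Ln_one_minus_radius_sums r)
      hence "(\<lambda>N. f N x) sums (- R m x)"
        by (simp add: f_def R_def r_def mult.assoc)
      thus ?thesis by (rule sums_unique[symmetric])
    qed
    moreover have "integral\<^sup>L unit_interval (f N) = r ^ Suc N * (c N / real (Suc N))" for N
      unfolding f_def using c[of N] by simp
    ultimately have "(\<lambda>N. r ^ Suc N * (c N / real (Suc N))) sums (- integral\<^sup>L unit_interval (R m))"
      by simp
    thus ?thesis by (simp only: r_def sums_iff minus_minus)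
  qed
  have 2: "(\<lambda>m. integral\<^sup>L unit_interval (R m)) \<longlonglongrightarrow> (LINT x|unit_interval. log_dist x * h x)"
  proof (rule integral_dominated_convergence)
    have ae: "AE x in unit_interval. x \<notin> \<int>"
      using AE_unit_interval_shift_not_Ints[of 0] by simp
    show "integrable unit_interval (\<lambda>x. log_majorant x * C)"
      using integrable_log_majorant[of 0] by (intro integrable_mult_left) simp
    show "AE x in unit_interval. (\<lambda>m. R m x) \<longlonglongrightarrow> log_dist x * h x"
      using ae
    proof eventually_elim
      case (elim x)
      have "(\<lambda>m. R m x) \<longlonglongrightarrow> Re (Ln (1 - ucirc x)) * h x"
        unfolding R_def by (intro tendsto_intros tendsto_Ln_radius elim)
      thus ?case using elim by (simp add: Re_Ln_one_minus_ucirc del: Re_Ln)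
    qed
    show "AE x in unit_interval. norm (R m x) \<le> log_majorant x * C" for m
      using ae
    proof eventually_elim
      case (elim x)
      have "\<bar>Re (Ln (1 - of_real (radius m) * ucirc x))\<bar> \<le> log_majorant x"
        using norm_Ln_one_minus_le[of "radius m" x] radius[of m] elim
          abs_Re_le_cmod[of "Ln (1 - of_real (radius m) * ucirc x)"] by linarith
      thus ?case
        unfolding R_def real_norm_def abs_mult by (intro mult_mono h) auto
    qed
  qed (unfold R_def, (intro measurable_unit_interval, measurable)+)
  \<comment> \<open>Tannery's theorem, with the terms of \<open>summ\<close> as dominating series.
    The limit is left as a power of 1 so that it has the same shape as the terms.\<close>
  have "(\<lambda>m. \<Sum>N. radius m ^ Suc N * (c N / real (Suc N))) \<longlonglongrightarrow> (\<Sum>N. 1 ^ Suc N * (c N / real (Suc N)))"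
  proof -
    have "norm (radius m ^ Suc N * (c N / real (Suc N))) \<le> \<bar>c N\<bar> / real (Suc N)" for m N
    proof -
      have "radius m ^ Suc N \<le> 1"
        using radius[of m] by (intro power_le_one) auto
      hence "radius m ^ Suc N * (\<bar>c N\<bar> / real (Suc N)) \<le> 1 * (\<bar>c N\<bar> / real (Suc N))"
        by (intro mult_right_mono) auto
      moreover have "norm (radius m ^ Suc N * (c N / real (Suc N))) = radius m ^ Suc N * (\<bar>c N\<bar> / real (Suc N))"
        using radius[of m] by (simp add: abs_mult)
      ultimately show ?thesis by simp
    qed
    moreover have "(\<lambda>m. radius m ^ Suc N * (c N / real (Suc N))) \<longlonglongrightarrow> 1 ^ Suc N * (c N / real (Suc N))" for N
      by (intro tendsto_intros radius_tendsto)
    ultimately show ?thesis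
      by (intro tannerys_theorem[THEN conjunct2, THEN conjunct2, OF _ _ summ])
        (auto intro!: always_eventually simp del: power_Suc power_one)
  qed
  hence "(\<lambda>m. integral\<^sup>L unit_interval (R m)) \<longlonglongrightarrow> - (\<Sum>N. c N / real (Suc N))"
    unfolding 1 by (intro tendsto_minus) simp
  with 2 show ?thesis by (rule LIMSEQ_unique)
qed

section \<open>Fourier coefficients of the sawtooth and its square\<close>

lemma integral_unit_interval_FTC:
  fixes F f :: "real \<Rightarrow> real"
  assumes "\<And>x. (F has_real_derivative f x) (at x)" "continuous_on UNIV f"
  shows "integral\<^sup>L unit_interval f = F 1 - F 0"
proof -
  have "has_bochner_integral lborel (\<lambda>x. f x * indicator {0..1} x) (F 1 - F 0)"
    using assms by (intro has_bochner_integral_FTC_Icc_real) (auto simp: continuous_on_eq_continuous_at)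
  thus ?thesis
    by (simp add: set_integral_eq_unit_interval[symmetric] set_lebesgue_integral_def
        has_bochner_integral_iff mult.commute)
qed

text \<open>Translation by \<open>s\<close>, allowed because \<open>N\<close> is an integer and the
  integrand has period 1, moves the shift into the cosine. Off the endpoints the sawtooth is then
  linear, so for polynomial \<open>p\<close> an elementary antiderivative exists.\<close>

lemma integral_cos_mult_sawtooth:
  fixes p :: "real \<Rightarrow> real"
  assumes p: "continuous_on UNIV p" "\<And>x. \<bar>p (sawtooth x)\<bar> \<le> C"
  shows "(LINT x|unit_interval. cos (2 * pi * real N * x) * p (sawtooth (x + s))) =
    (LINT x|unit_interval. cos (2 * pi * real N * (x - s)) * p (x - 1 / 2))"
proof -
  define f where "f x = cos (2 * pi * real N * (x - s)) * p (sawtooth x)" for x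
  have [measurable]: "p \<in> borel_measurable borel"
    using p by (intro borel_measurable_continuous_onI)
  have fm: "f \<in> borel_measurable borel"
    unfolding f_def by measurable
  have fb: "norm (f x) \<le> C" for x
    using mult_mono[of "\<bar>cos (2 * pi * real N * (x - s))\<bar>" 1 "\<bar>p (sawtooth x)\<bar>" C] p(2)[of x]
    by (auto simp: f_def abs_mult)
  have per: "f (x + 1) = f x" for x
  proof -
    have "cos (2 * pi * real N * (x + 1 - s)) = cos (2 * pi * real N * (x - s) + 2 * pi * real N)"
      by (simp add: algebra_simps)
    also have "\<dots> = cos (2 * pi * real N * (x - s))"
      using cos_npi[of "2 * N"] sin_npi[of "2 * N"] by (simp add: cos_add mult_ac)
    finally show ?thesis by (simp add: f_def)
  qed
  have "(LINT x|unit_interval. f (x + s)) = integral\<^sup>L unit_interval f"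
    by (rule has_bochner_integral_integral_eq[OF has_bochner_integral_periodic_shift[of f, OF per]])
      (rule integrable_unit_interval_bounded[OF fm fb])
  also have "\<dots> = (LINT x|unit_interval. cos (2 * pi * real N * (x - s)) * p (x - 1 / 2))"
  proof (rule integral_cong_AE)
    have "AE x in unit_interval. x \<notin> {0, 1}"
      by (rule AE_unit_interval_not_in_countable) auto
    thus "AE x in unit_interval. f x = cos (2 * pi * real N * (x - s)) * p (x - 1 / 2)"
      using AE_space
    proof eventually_elim
      case (elim x)
      hence "frac x = x" by (simp add: frac_eq)
      thus ?case by (simp add: f_def sawtooth_def)
    qed
  qed (use fm in \<open>auto intro!: measurable_unit_interval\<close>)
  finally show ?thesis by (simp add: f_def)
qed

text \<open>The antiderivatives come from integration by parts. Sine and cosine take equal values at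
  both ends, so only jumps across the period survive: the jump 1 of \<open>x - 1 / 2\<close> gives
  the sine coefficient, the jump 2 of the derivative of its square gives the cosine
  coefficient.\<close>

lemma
  fixes N :: nat and s :: real
  assumes N: "0 < N"
  shows integral_cos: "(LINT x|unit_interval. cos (2 * pi * real N * x)) = 0"
    and integral_cos_mult_sawtooth_1:
      "(LINT x|unit_interval. cos (2 * pi * real N * x) * sawtooth (x + s)) =
        - sin (2 * pi * real N * s) / (2 * pi * real N)"
    and integral_cos_mult_sawtooth_2:
      "(LINT x|unit_interval. cos (2 * pi * real N * x) * sawtooth (x + s) ^ 2) =
        2 * cos (2 * pi * real N * s) / (2 * pi * real N) ^ 2"
proof -
  define w where "w = 2 * pi * real N"
  have w: "w \<noteq> 0" using N by (simp add: w_def)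
  have sw: "sin (w * (1 - s)) = - sin (w * s)" "cos (w * (1 - s)) = cos (w * s)"
    using cos_npi[of "2 * N"] sin_npi[of "2 * N"]
    by (simp_all add: w_def right_diff_distrib sin_diff cos_diff mult_ac)
  have sw': "sin w = 0" using sin_npi[of "2 * N"] by (simp add: w_def mult_ac)
  have "(LINT x|unit_interval. cos (w * x)) = sin (w * 1) / w - sin (w * 0) / w"
    by (rule integral_unit_interval_FTC)
      (use w in \<open>auto intro!: derivative_eq_intros continuous_intros\<close>)
  thus "(LINT x|unit_interval. cos (2 * pi * real N * x)) = 0"
    using sw' by (simp add: w_def)
  have "(LINT x|unit_interval. cos (w * (x - s)) * (x - 1 / 2)) =
      (sin (w * (1 - s)) * (1 - 1 / 2) / w + cos (w * (1 - s)) / w ^ 2) -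
      (sin (w * (0 - s)) * (0 - 1 / 2) / w + cos (w * (0 - s)) / w ^ 2)"
    by (rule integral_unit_interval_FTC)
      (use w in \<open>auto intro!: derivative_eq_intros continuous_intros simp: field_simps power2_eq_square\<close>)
  also have "\<dots> = - sin (w * s) / w"
    unfolding sw using w by (simp add: field_simps)
  finally show "(LINT x|unit_interval. cos (2 * pi * real N * x) * sawtooth (x + s)) =
        - sin (2 * pi * real N * s) / (2 * pi * real N)"
    using integral_cos_mult_sawtooth[of "\<lambda>y. y" 1 N s] abs_sawtooth_le by (simp add: w_def)
  have "(LINT x|unit_interval. cos (w * (x - s)) * (x - 1 / 2) ^ 2) =
      (sin (w * (1 - s)) * (1 - 1 / 2) ^ 2 / w + 2 * (1 - 1 / 2) * cos (w * (1 - s)) / w ^ 2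
        - 2 * sin (w * (1 - s)) / w ^ 3) -
      (sin (w * (0 - s)) * (0 - 1 / 2) ^ 2 / w + 2 * (0 - 1 / 2) * cos (w * (0 - s)) / w ^ 2
        - 2 * sin (w * (0 - s)) / w ^ 3)"
    by (rule integral_unit_interval_FTC)
      (use w in \<open>auto intro!: derivative_eq_intros continuous_intros
        simp: field_simps power2_eq_square power3_eq_cube\<close>)
  also have "\<dots> = 2 * cos (w * s) / w ^ 2"
    unfolding sw using w by (simp add: field_simps)
  finally show "(LINT x|unit_interval. cos (2 * pi * real N * x) * sawtooth (x + s) ^ 2) =
        2 * cos (2 * pi * real N * s) / (2 * pi * real N) ^ 2"
    using integral_cos_mult_sawtooth[of "\<lambda>y. y ^ 2" 1 N s] abs_sawtooth_le
    by (simp add: w_def continuous_intros power_le_one abs_square_le_1 flip: power_abs)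
qed

lemma summable_inverse_Suc_power:
  assumes "2 \<le> k"
  shows "summable (\<lambda>N. C / real (Suc N) ^ k)"
proof -
  have "summable (\<lambda>N. inverse (real (Suc N) ^ k))"
    using inverse_power_summable[OF assms, where 'a = real] by (subst summable_Suc_iff)
  thus ?thesis using summable_mult[of _ C] by (simp only: divide_inverse)
qed

lemma integral_log_dist: "(LINT x|unit_interval. log_dist x) = 0"
  using integral_log_dist_mult[of "\<lambda>_. 1" 1 "\<lambda>_. 0"] integral_cos[of "Suc N" for N] by simp

text \<open>The coefficient of the sawtooth supplies one factor \<open>1 / N\<close> and the
  logarithm another, hence order 2; the two minus signs cancel.\<close>

lemma integral_log_dist_mult_sawtooth:
  "(LINT x|unit_interval. log_dist x * sawtooth (x + s)) = clausen_S 2 (2 * pi * s) / (2 * pi)"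
proof -
  define c where "c N = - sin (2 * pi * real (Suc N) * s) / (2 * pi * real (Suc N))" for N
  have "\<bar>c N\<bar> / real (Suc N) \<le> 1 / real (Suc N) ^ 2" for N
  proof -
    have "\<bar>c N\<bar> / real (Suc N) = \<bar>sin (2 * pi * real (Suc N) * s)\<bar> / (2 * pi) / real (Suc N) ^ 2"
      by (simp add: c_def abs_mult power2_eq_square)
    also have "\<dots> \<le> 1 / real (Suc N) ^ 2"
    proof (rule divide_right_mono)
      have "\<bar>sin (2 * pi * real (Suc N) * s)\<bar> \<le> 1 * (2 * pi)"
        using pi_ge_two abs_sin_le_one[of "2 * pi * real (Suc N) * s"] by linarith
      thus "\<bar>sin (2 * pi * real (Suc N) * s)\<bar> / (2 * pi) \<le> 1"
        by (subst pos_divide_le_eq) auto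
    qed simp
    finally show ?thesis .
  qed
  hence summ: "summable (\<lambda>N. \<bar>c N\<bar> / real (Suc N))"
    by (intro summable_comparison_test'[OF summable_inverse_Suc_power[of 2 1]]) auto
  have "(LINT x|unit_interval. log_dist x * sawtooth (x + s)) = - (\<Sum>N. c N / real (Suc N))"
    by (rule integral_log_dist_mult[OF _ _ _ summ])
      (use abs_sawtooth_le in \<open>auto simp: integral_cos_mult_sawtooth_1 c_def simp del: of_nat_Suc\<close>)
  also have "\<dots> = (\<Sum>N. - (c N / real (Suc N)))"
    using summ by (intro suminf_minus[symmetric]) (auto intro: summable_rabs_cancel)
  also have "\<dots> = (\<Sum>N. sin (real (Suc N) * (2 * pi * s)) / real (Suc N) ^ 2 / (2 * pi))"
    by (intro suminf_cong) (simp add: c_def power2_eq_square mult_ac del: of_nat_Suc)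
  also have "\<dots> = clausen_S 2 (2 * pi * s) / (2 * pi)"
    unfolding clausen_S_def
    by (intro suminf_divide summable_comparison_test'[OF summable_inverse_Suc_power[of 2 1]])
      (auto intro!: divide_right_mono)
  finally show ?thesis .
qed

text \<open>Here the coefficient decays like \<open>1 / N ^ 2\<close>, hence order 3, and the minus
  sign of the logarithm remains.\<close>

lemma integral_log_dist_mult_sawtooth_sq:
  "(LINT x|unit_interval. log_dist x * sawtooth (x + s) ^ 2) = - clausen_C 3 (2 * pi * s) / (2 * pi ^ 2)"
proof -
  define c where "c N = 2 * cos (2 * pi * real (Suc N) * s) / (2 * pi * real (Suc N)) ^ 2" for N
  have eq: "c N / real (Suc N) = cos (real (Suc N) * (2 * pi * s)) / real (Suc N) ^ 3 / (2 * pi ^ 2)" for N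
    by (simp add: c_def power2_eq_square power3_eq_cube mult_ac del: of_nat_Suc)
  have s3: "summable (\<lambda>N. cos (real (Suc N) * (2 * pi * s)) / real (Suc N) ^ 3)"
    "summable (\<lambda>N. \<bar>cos (real (Suc N) * (2 * pi * s)) / real (Suc N) ^ 3\<bar>)"
    by (intro summable_comparison_test'[OF summable_inverse_Suc_power[of 3 1]];
        force intro!: divide_right_mono)+
  have "\<bar>c N\<bar> / real (Suc N) = \<bar>c N / real (Suc N)\<bar>" for N by simp
  hence "\<bar>c N\<bar> / real (Suc N) = \<bar>cos (real (Suc N) * (2 * pi * s)) / real (Suc N) ^ 3\<bar> / (2 * pi ^ 2)" for N
    unfolding eq by (simp only: abs_divide) simp
  hence summ: "summable (\<lambda>N. \<bar>c N\<bar> / real (Suc N))"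
    using summable_divide[OF s3(2), of "2 * pi ^ 2"] by simp
  have "(LINT x|unit_interval. log_dist x * sawtooth (x + s) ^ 2) = - (\<Sum>N. c N / real (Suc N))"
    by (rule integral_log_dist_mult[OF _ _ _ summ, where C = 1])
      (use abs_sawtooth_le in \<open>auto simp: integral_cos_mult_sawtooth_2 c_def abs_square_le_1 simp del: of_nat_Suc\<close>)
  also have "(\<Sum>N. c N / real (Suc N)) = clausen_C 3 (2 * pi * s) / (2 * pi ^ 2)"
    unfolding eq clausen_C_def by (intro suminf_divide s3)
  finally show ?thesis by simp
qed

section \<open>The third moment\<close>

text \<open>The bound on \<open>l\<close> gives the convergence used to pull the sign out of the
  series.\<close>

lemma clausen_S_minus: "clausen_S l (- t) = - clausen_S l t" if "2 \<le> l"
proof -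
  have "summable (\<lambda>N. sin (real (Suc N) * t) / real (Suc N) ^ l)"
    by (rule summable_comparison_test'[OF summable_inverse_Suc_power[OF that, of 1]])
      (auto intro!: divide_right_mono)
  thus ?thesis unfolding clausen_S_def by (simp add: suminf_minus)
qed

lemma clausen_C_minus: "clausen_C l (- t) = clausen_C l t"
  by (simp add: clausen_C_def)

lemma clausen_C_0: "clausen_C l 0 = zeta l"
  by (simp add: clausen_C_def zeta_def)

lemma clausen_S_0: "clausen_S l 0 = 0"
  by (simp add: clausen_S_def)

text \<open>Translation by \<open>a\<close> moves the singularity of the logarithm to the integers,
  so the integrals computed for \<open>log_dist x\<close> can be used.\<close>

lemma integral_log_dist_mult_periodic:
  fixes h :: "real \<Rightarrow> real"
  assumes h: "h \<in> borel_measurable borel" "\<And>x. \<bar>h x\<bar> \<le> C" "\<And>x. h (x + 1) = h x"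
  shows "(LINT x|unit_interval. log_dist (x - a) * h (x - b)) =
    (LINT x|unit_interval. log_dist x * h (x + (a - b)))"
proof -
  define f where "f x = log_dist x * h (x + (a - b))" for x
  have per: "f (x + 1) = f x" for x
  proof -
    have "x + 1 + (a - b) = x + (a - b) + 1" by simp
    thus ?thesis by (simp only: f_def log_dist_add_1 h(3))
  qed
  have "integrable unit_interval (\<lambda>x. log_dist (x + 0) * h (x + (a - b)))"
    by (rule integrable_log_dist_mult[where C = C]) (use h in measurable)
  hence "integrable unit_interval f" by (simp add: f_def [abs_def])
  from has_bochner_integral_periodic_shift[of f, OF per this, of "- a"]
  show ?thesis by (simp add: has_bochner_integral_iff f_def [abs_def])
qed

section \<open>Pairs of indices and products of sawtooth functions\<close>

lemma sum_square_split_diagonal: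
  fixes X :: "nat \<Rightarrow> nat \<Rightarrow> 'a :: comm_monoid_add"
  shows "(\<Sum>i=1..n. \<Sum>j=1..n. X i j) =
    (\<Sum>i=1..n. X i i) + (\<Sum>(k, l) \<in> {(k, l). 1 \<le> k \<and> k < l \<and> l \<le> n}. X k l + X l k)"
proof -
  define U where "U = {(k, l). 1 \<le> k \<and> k < l \<and> l \<le> n}"
  have fin: "finite U" by (rule finite_subset[of _ "{1..n} \<times> {1..n}"]) (auto simp: U_def)
  have "(\<Sum>i=1..n. \<Sum>j=1..n. X i j) = (\<Sum>(i, j) \<in> {1..n} \<times> {1..n}. X i j)"
    by (rule sum.cartesian_product)
  also have "{1..n} \<times> {1..n} = (\<lambda>i. (i, i)) ` {1..n} \<union> (U \<union> prod.swap ` U)"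
    by (auto simp: U_def image_iff)
  also have "(\<Sum>(i, j) \<in> \<dots>. X i j) = (\<Sum>(i, j) \<in> (\<lambda>i. (i, i)) ` {1..n}. X i j) +
      (\<Sum>(i, j) \<in> U \<union> prod.swap ` U. X i j)"
    by (rule sum.union_disjoint) (use fin in \<open>auto simp: U_def\<close>)
  also have "(\<Sum>(i, j) \<in> (\<lambda>i. (i, i)) ` {1..n}. X i j) = (\<Sum>i=1..n. X i i)"
    by (subst sum.reindex) (auto simp: inj_on_def)
  also have "(\<Sum>(i, j) \<in> U \<union> prod.swap ` U. X i j) = (\<Sum>(i, j) \<in> U. X i j) + (\<Sum>(i, j) \<in> prod.swap ` U. X i j)"
    by (rule sum.union_disjoint) (use fin in \<open>auto simp: U_def\<close>)
  also have "(\<Sum>(i, j) \<in> prod.swap ` U. X i j) = (\<Sum>(i, j) \<in> U. X j i)"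
    by (subst sum.reindex) (auto simp: case_prod_unfold)
  also have "(\<Sum>(i, j) \<in> U. X i j) + (\<Sum>(i, j) \<in> U. X j i) = (\<Sum>(k, l) \<in> U. X k l + X l k)"
    by (simp add: sum.distrib case_prod_unfold)
  finally show ?thesis by (simp add: U_def)
qed

text \<open>
  Away from ties this is \<open>sawtooth (\<alpha> k - \<alpha> j)\<close>. Comparing the indices rather than the
  values keeps \<open>sawtooth_mult\<close> valid when \<open>\<alpha> j = \<alpha> k\<close> with \<open>j \<noteq> k\<close>.
\<close>

definition ordered_offset :: "(nat \<Rightarrow> real) \<Rightarrow> nat \<Rightarrow> nat \<Rightarrow> real" where
  "ordered_offset \<alpha> j k = (if j < k then \<alpha> k - \<alpha> j - 1 / 2
     else if k < j then \<alpha> k - \<alpha> j + 1 / 2 else 0)"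

lemma ordered_offset_swap: "ordered_offset \<alpha> k j = - ordered_offset \<alpha> j k"
  by (simp add: ordered_offset_def)

text \<open>The \<open>j - 1\<close> indices below \<open>j\<close> contribute 1/2 each and the
  \<open>n - j\<close> above contribute -1/2 each, a net \<open>j - (n + 1) / 2\<close>. This is
  where the index difference in the final formula originates.\<close>

lemma sum_ordered_offset:
  assumes "j \<in> {1..n}"
  shows "(\<Sum>k=1..n. ordered_offset \<alpha> j k) =
    (\<Sum>k=1..n. \<alpha> k) - real n * \<alpha> j + real j - (real n + 1) / 2"
proof -
  have "(\<Sum>k=1..n. ordered_offset \<alpha> j k) =
      (\<Sum>k=1..n. (\<alpha> k - \<alpha> j) + ((if k < j then 1 / 2 else 0) - (if j < k then 1 / 2 else 0)))"
    by (intro sum.cong) (auto simp: ordered_offset_def)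
  also have "\<dots> = (\<Sum>k=1..n. \<alpha> k) - real n * \<alpha> j +
      ((\<Sum>k=1..n. if k < j then 1 / 2 else 0) - (\<Sum>k=1..n. if j < k then 1 / 2 else 0))"
    by (simp add: sum.distrib sum_subtractf)
  also have "(\<Sum>k=1..n. if k < j then 1 / 2 else 0 :: real) = (\<Sum>k\<in>{1..<j}. 1 / 2)"
    using assms by (intro sum.mono_neutral_cong_right) auto
  also have "(\<Sum>k=1..n. if j < k then 1 / 2 else 0 :: real) = (\<Sum>k\<in>{j<..n}. 1 / 2)"
    using assms by (intro sum.mono_neutral_cong_right) auto
  finally show ?thesis
    using assms by (simp add: of_nat_diff field_simps)
qed

lemma sawtooth_of_nonneg:
  assumes "0 \<le> x" "x < 1"
  shows "sawtooth x = x - 1 / 2"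
  using assms by (simp add: sawtooth_def frac_eq)

lemma sawtooth_of_neg:
  assumes "-1 \<le> x" "x < 0"
  shows "sawtooth x = x + 1 / 2"
  using assms sawtooth_add_1[of x] sawtooth_of_nonneg[of "x + 1"] by simp

lemma sawtooth_diff_eq:
  assumes "0 \<le> a" "a < 1" "0 \<le> x" "x < 1"
  shows "sawtooth (x - a) = (if a \<le> x then x - a - 1 / 2 else x - a + 1 / 2)"
  using assms by (auto intro: sawtooth_of_nonneg sawtooth_of_neg)

text \<open>For distinct indices, \<open>a - b\<close> differs from the offset \<open>d\<close> by
  exactly 1/2 up to sign, wherever \<open>x\<close> lies relative to the two jumps; expanding the
  square isolates the product. For \<open>j = k\<close> the difference is 0, hence the separate
  constant.\<close>

lemma sawtooth_mult:
  fixes \<alpha> :: "nat \<Rightarrow> real"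
  assumes range: "\<And>j. j \<in> A \<Longrightarrow> 0 \<le> \<alpha> j \<and> \<alpha> j < 1"
    and sorted: "mono_on A \<alpha>" and jk: "j \<in> A" "k \<in> A" and x: "0 \<le> x" "x < 1"
  shows "sawtooth (x - \<alpha> j) * sawtooth (x - \<alpha> k) =
    (sawtooth (x - \<alpha> j) ^ 2 + sawtooth (x - \<alpha> k) ^ 2) / 2
    + (if j = k then 0 else (ordered_offset \<alpha> j k ^ 2 - 1 / 4) / 2)
    - ordered_offset \<alpha> j k * (sawtooth (x - \<alpha> j) - sawtooth (x - \<alpha> k))"
proof (cases "j = k")
  case True
  thus ?thesis by (simp add: ordered_offset_def power2_eq_square)
next
  case False
  define a b d where "a = sawtooth (x - \<alpha> j)" "b = sawtooth (x - \<alpha> k)" "d = ordered_offset \<alpha> j k"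
  have "j < k \<Longrightarrow> \<alpha> j \<le> \<alpha> k" "k < j \<Longrightarrow> \<alpha> k \<le> \<alpha> j"
    using sorted jk by (auto dest: mono_onD)
  moreover have "j < k \<or> k < j" using False by auto
  ultimately have "a - b - d = 1 / 2 \<or> a - b - d = - (1 / 2)"
    using range[OF jk(1)] range[OF jk(2)] x
    by (auto simp: a_b_d_def ordered_offset_def sawtooth_diff_eq)
  hence "(a - b - d) ^ 2 = (1 / 2) ^ 2"
    unfolding power2_eq_iff .
  hence "a * b = (a ^ 2 + b ^ 2) / 2 + (d ^ 2 - 1 / 4) / 2 - d * (a - b)"
    by (simp add: power2_eq_square field_simps)
  thus ?thesis using False by (simp add: a_b_d_def)
qed

text \<open>After \<open>sawtooth_mult\<close> the squares produce the \<open>clausen_C\<close>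
  terms and the linear terms the \<open>clausen_S\<close> terms, while the constant \<open>c\<close>
  disappears because \<open>log_dist\<close> has mean 0.\<close>

lemma integral_log_dist_sawtooth_sawtooth:
  fixes \<alpha> :: "nat \<Rightarrow> real"
  assumes range: "\<And>j. j \<in> A \<Longrightarrow> 0 \<le> \<alpha> j \<and> \<alpha> j < 1"
    and sorted: "mono_on A \<alpha>" and jk: "j \<in> A" "k \<in> A"
  shows "(LINT x|unit_interval. log_dist (x - a) * (sawtooth (x - \<alpha> j) * sawtooth (x - \<alpha> k))) =
    - (clausen_C 3 (2 * pi * (a - \<alpha> j)) + clausen_C 3 (2 * pi * (a - \<alpha> k))) / (4 * pi ^ 2)
    - ordered_offset \<alpha> j k *
      (clausen_S 2 (2 * pi * (a - \<alpha> j)) - clausen_S 2 (2 * pi * (a - \<alpha> k))) / (2 * pi)"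
proof -
  define c where "c = (if j = k then 0 else (ordered_offset \<alpha> j k ^ 2 - 1 / 4) / 2)"
  define d where "d = ordered_offset \<alpha> j k"
  have I0: "integrable unit_interval (\<lambda>x. log_dist (x - a) * 1)"
    using integrable_log_dist_mult[of "\<lambda>_. 1" 1 "- a"] by simp
  have I1: "integrable unit_interval (\<lambda>x. log_dist (x - a) * sawtooth (x - b))" for b
    using integrable_log_dist_mult[of "\<lambda>x. sawtooth (x - b)" 1 "- a"] abs_sawtooth_le by simp
  have I2: "integrable unit_interval (\<lambda>x. log_dist (x - a) * sawtooth (x - b) ^ 2)" for b
    using integrable_log_dist_mult[of "\<lambda>x. sawtooth (x - b) ^ 2" 1 "- a"] abs_sawtooth_le
    by (simp add: abs_square_le_1)
  have J0: "(LINT x|unit_interval. log_dist (x - a) * 1) = 0"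
    using integral_log_dist_mult_periodic[of "\<lambda>_. 1" 1 a a] by (simp add: integral_log_dist)
  have J1: "(LINT x|unit_interval. log_dist (x - a) * sawtooth (x - b)) = clausen_S 2 (2 * pi * (a - b)) / (2 * pi)" for b
    using integral_log_dist_mult_periodic[of sawtooth 1 a b] abs_sawtooth_le
    by (simp add: integral_log_dist_mult_sawtooth)
  have J2: "(LINT x|unit_interval. log_dist (x - a) * sawtooth (x - b) ^ 2) =
      - clausen_C 3 (2 * pi * (a - b)) / (2 * pi ^ 2)" for b
    using integral_log_dist_mult_periodic[of "\<lambda>x. sawtooth x ^ 2" 1 a b] abs_sawtooth_le
    by (simp add: integral_log_dist_mult_sawtooth_sq abs_square_le_1)
  \<comment> \<open>\<open>sawtooth_mult\<close> covers only the half-open interval.\<close>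
  have "AE x in unit_interval. x \<notin> {1}"
    by (rule AE_unit_interval_not_in_countable) auto
  hence ae: "AE x in unit_interval. log_dist (x - a) * (sawtooth (x - \<alpha> j) * sawtooth (x - \<alpha> k)) =
      1 / 2 * (log_dist (x - a) * sawtooth (x - \<alpha> j) ^ 2)
      + 1 / 2 * (log_dist (x - a) * sawtooth (x - \<alpha> k) ^ 2)
      + c * (log_dist (x - a) * 1)
      - d * (log_dist (x - a) * sawtooth (x - \<alpha> j))
      + d * (log_dist (x - a) * sawtooth (x - \<alpha> k))"
    using AE_space
  proof eventually_elim
    case (elim x)
    hence x: "0 \<le> x" "x < 1" by auto
    have "sawtooth (x - \<alpha> j) * sawtooth (x - \<alpha> k) =
        (sawtooth (x - \<alpha> j) ^ 2 + sawtooth (x - \<alpha> k) ^ 2) / 2 + c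
        - d * (sawtooth (x - \<alpha> j) - sawtooth (x - \<alpha> k))"
      unfolding c_def d_def by (rule sawtooth_mult[of A, OF _ sorted jk x]) (rule range)
    thus ?case
      by (simp only:) (simp add: algebra_simps add_divide_distrib)
  qed
  have "(LINT x|unit_interval. log_dist (x - a) * (sawtooth (x - \<alpha> j) * sawtooth (x - \<alpha> k))) =
      (LINT x|unit_interval. 1 / 2 * (log_dist (x - a) * sawtooth (x - \<alpha> j) ^ 2)
      + 1 / 2 * (log_dist (x - a) * sawtooth (x - \<alpha> k) ^ 2)
      + c * (log_dist (x - a) * 1)
      - d * (log_dist (x - a) * sawtooth (x - \<alpha> j))
      + d * (log_dist (x - a) * sawtooth (x - \<alpha> k)))"
    by (rule integral_cong_AE[OF _ _ ae]) (intro measurable_unit_interval, measurable)+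
  also have "\<dots> = 1 / 2 * (- clausen_C 3 (2 * pi * (a - \<alpha> j)) / (2 * pi ^ 2))
      + 1 / 2 * (- clausen_C 3 (2 * pi * (a - \<alpha> k)) / (2 * pi ^ 2)) + c * 0
      - d * (clausen_S 2 (2 * pi * (a - \<alpha> j)) / (2 * pi))
      + d * (clausen_S 2 (2 * pi * (a - \<alpha> k)) / (2 * pi))"
    by (intro has_bochner_integral_integral_eq has_bochner_integral_add has_bochner_integral_diff
        has_bochner_integral_mult_right)
      (simp_all only: has_bochner_integral_iff I0 I1 I2 J0 J1 J2 simp_thms)
  finally show ?thesis by (simp add: d_def field_simps)
qed

section \<open>Assembly of the formula\<close>

lemma norm_poly_prod_unit_roots:
  fixes \<alpha> :: "nat \<Rightarrow> real"
  shows "cmod (poly (\<Prod>j\<in>A. [:- exp (2 * of_real pi * \<i> * of_real (\<alpha> j)), 1:]) (exp (2 * of_real pi * \<i> * of_real x))) =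
    (\<Prod>j\<in>A. cmod (1 - ucirc (x - \<alpha> j)))"
proof -
  have e: "exp (2 * of_real pi * \<i> * of_real y) = ucirc y" for y
    by (simp add: ucirc_def cis_conv_exp mult_ac)
  have "cmod (ucirc x - ucirc b) = cmod (1 - ucirc (x - b))" for b
  proof -
    have "ucirc x - ucirc b = - (ucirc b * (1 - ucirc (x - b)))"
      using ucirc_add[of b "x - b"] by (simp add: algebra_simps)
    thus ?thesis by (simp only: norm_minus_cancel norm_mult norm_ucirc mult_1)
  qed
  thus ?thesis unfolding e by (simp add: poly_prod flip: prod_norm)
qed

theorem theorem4:
  fixes n :: nat and \<alpha> :: "nat \<Rightarrow> real" and P :: "complex poly"
  assumes range: "\<And>j. j \<in> {1..n} \<Longrightarrow> 0 \<le> \<alpha> j \<and> \<alpha> j < 1"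
    and sorted: "mono_on {1..n} \<alpha>"
    and P: "P = (\<Prod>j=1..n. [:- exp (2 * of_real pi * \<i> * of_real (\<alpha> j)), 1:])"
  shows "m3 P =
    - (3 / 2) * (real n)\<^sup>2 * zeta 3
    - 3 * real n * (\<Sum>(k, l) \<in> {(k, l). 1 \<le> k \<and> k < l \<and> l \<le> n}.
        clausen_C 3 (2 * pi * (\<alpha> l - \<alpha> k)))
    - 3 * pi * (\<Sum>(k, l) \<in> {(k, l). 1 \<le> k \<and> k < l \<and> l \<le> n}.
        clausen_S 2 (2 * pi * (\<alpha> l - \<alpha> k)) *
        (real n * (\<alpha> l - \<alpha> k) - (real l - real k)))"
proof -
  define A where "A = {1..n}"
  define U where "U = {(k, l). 1 \<le> k \<and> k < l \<and> l \<le> n}"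
  define f where "f x = (\<Sum>j\<in>A. Ln (1 - ucirc (x - \<alpha> j)))" for x
  define u where "u x = (\<Sum>j\<in>A. log_dist (x - \<alpha> j))" for x
  define v where "v x = (\<Sum>j\<in>A. sawtooth (x - \<alpha> j))" for x
  define T where "T i j k x = log_dist (x - \<alpha> i) * (sawtooth (x - \<alpha> j) * sawtooth (x - \<alpha> k))" for i j k x
  define d where "d = ordered_offset \<alpha>"
  define F where "F i j = clausen_C 3 (2 * pi * (\<alpha> i - \<alpha> j))" for i j
  define G where "G i j = clausen_S 2 (2 * pi * (\<alpha> i - \<alpha> j))" for i j
  have [measurable]: "f \<in> borel_measurable borel" "u \<in> borel_measurable borel" "v \<in> borel_measurable borel"
    unfolding f_def u_def v_def by measurable
  have ae: "AE x in unit_interval. \<forall>j\<in>A. x - \<alpha> j \<notin> \<int>"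
    using AE_unit_interval_shift_not_Ints[of "- \<alpha> j" for j]
    by (intro AE_finite_allI) (auto simp: A_def)

  have intT: "integrable unit_interval (T i j k)" for i j k
  proof -
    have "\<bar>sawtooth (x - \<alpha> j) * sawtooth (x - \<alpha> k)\<bar> \<le> 1" for x
      unfolding abs_mult by (intro mult_le_one abs_sawtooth_le) auto
    thus ?thesis
      using integrable_log_dist_mult[of "\<lambda>x. sawtooth (x - \<alpha> j) * sawtooth (x - \<alpha> k)" 1 "- \<alpha> i"]
      by (simp add: T_def [abs_def])
  qed
  have uvv: "u x * v x ^ 2 = (\<Sum>i\<in>A. \<Sum>j\<in>A. \<Sum>k\<in>A. T i j k x)" for x
    unfolding u_def v_def T_def power2_eq_square sum_product sum_distrib_right
    by (simp only: sum_distrib_left)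
  have int_uvv: "integrable unit_interval (\<lambda>x. u x * v x ^ 2)"
    unfolding uvv by (intro Bochner_Integration.integrable_sum intT)

  have "m3 P = (LINT x|unit_interval. (ln (\<Prod>j\<in>A. cmod (1 - ucirc (x - \<alpha> j)))) ^ 3)"
    unfolding m3_def P norm_poly_prod_unit_roots set_integral_eq_unit_interval A_def ..
  \<comment> \<open>With \<open>f = u + i pi v\<close> the real part of the cube is
    \<open>u^3 - 3 pi^2 u v^2\<close>. Off the null set excluded by \<open>ae\<close> no factor of
    the product vanishes, so its logarithm splits into \<open>u\<close>.\<close>
  also have "\<dots> = (LINT x|unit_interval. Re (f x ^ 3) + 3 * pi ^ 2 * (u x * v x ^ 2))"
  proof (rule integral_cong_AE)
    show "AE x in unit_interval. (ln (\<Prod>j\<in>A. cmod (1 - ucirc (x - \<alpha> j)))) ^ 3 =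
        Re (f x ^ 3) + 3 * pi ^ 2 * (u x * v x ^ 2)"
      using ae
    proof eventually_elim
      case (elim x)
      have "ln (\<Prod>j\<in>A. cmod (1 - ucirc (x - \<alpha> j))) = u x"
        unfolding u_def log_dist_def using elim by (intro ln_prod) (auto simp: A_def)
      moreover have "f x = Complex (u x) (pi * v x)"
        using elim by (simp add: complex_eq_iff f_def u_def v_def sum_distrib_left
            Re_Ln_one_minus_ucirc Im_Ln_one_minus_ucirc del: Re_Ln)
      ultimately show ?case
        by (simp add: power3_eq_cube power2_eq_square algebra_simps)
    qed
  qed (intro measurable_unit_interval, measurable)+
  also have "\<dots> = 3 * pi ^ 2 * (LINT x|unit_interval. u x * v x ^ 2)"
  proof -
    have "has_bochner_integral unit_interval (\<lambda>x. Re (f x ^ 3)) (Re 0)"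
      unfolding f_def by (intro has_bochner_integral_Re has_bochner_integral_sum_Ln_cubed) (simp add: A_def)
    moreover have "has_bochner_integral unit_interval (\<lambda>x. 3 * pi ^ 2 * (u x * v x ^ 2))
        (3 * pi ^ 2 * (LINT x|unit_interval. u x * v x ^ 2))"
      by (intro has_bochner_integral_mult_right has_bochner_integral_integrable int_uvv)
    ultimately show ?thesis
      using has_bochner_integral_add has_bochner_integral_integral_eq by fastforce
  qed
  also have "(LINT x|unit_interval. u x * v x ^ 2) =
      (\<Sum>i\<in>A. \<Sum>j\<in>A. \<Sum>k\<in>A. - (F i j + F i k) / (4 * pi ^ 2) - d j k * (G i j - G i k) / (2 * pi))"
  proof -
    have "integral\<^sup>L unit_interval (T i j k) =
        - (F i j + F i k) / (4 * pi ^ 2) - d j k * (G i j - G i k) / (2 * pi)" if "j \<in> A" "k \<in> A" for i j k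
      unfolding T_def F_def G_def d_def
      by (rule integral_log_dist_sawtooth_sawtooth[of A]) (use that range sorted in \<open>auto simp: A_def\<close>)
    thus ?thesis
      unfolding uvv by (simp add: Bochner_Integration.integral_sum intT Bochner_Integration.integrable_sum)
  qed
  \<comment> \<open>Each \<open>F\<close> term is free of one of the three indices, which gives the
    factor \<open>n\<close>. Exchanging \<open>j\<close> and \<open>k\<close> and using that
    \<open>d\<close> is antisymmetric shows that the two \<open>G\<close> terms contribute
    equally.\<close>
  also have "\<dots> = - real n * (\<Sum>i\<in>A. \<Sum>j\<in>A. F i j) / (2 * pi ^ 2)
      - (\<Sum>i\<in>A. \<Sum>j\<in>A. G i j * (\<Sum>k\<in>A. d j k)) / pi"
  proof -
    have F: "(\<Sum>i\<in>A. \<Sum>j\<in>A. \<Sum>k\<in>A. F i j + F i k) = 2 * real n * (\<Sum>i\<in>A. \<Sum>j\<in>A. F i j)"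
      by (simp add: sum.distrib A_def sum_distrib_left[symmetric])
    have "(\<Sum>j\<in>A. \<Sum>k\<in>A. d j k * G i k) = - (\<Sum>j\<in>A. \<Sum>k\<in>A. d j k * G i j)" for i
    proof -
      have "(\<Sum>j\<in>A. \<Sum>k\<in>A. d j k * G i k) = (\<Sum>j\<in>A. \<Sum>k\<in>A. d k j * G i j)"
        by (rule sum.swap)
      also have "\<dots> = (\<Sum>j\<in>A. \<Sum>k\<in>A. - (d j k * G i j))"
        using ordered_offset_swap[of \<alpha>] by (intro sum.cong refl) (metis d_def mult_minus_left)
      finally show ?thesis by (simp only: sum_negf)
    qed
    hence G: "(\<Sum>i\<in>A. \<Sum>j\<in>A. \<Sum>k\<in>A. d j k * (G i j - G i k)) = 2 * (\<Sum>i\<in>A. \<Sum>j\<in>A. G i j * (\<Sum>k\<in>A. d j k))"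
      by (simp add: right_diff_distrib sum_subtractf sum_distrib_left mult_ac)
    show ?thesis
      unfolding sum_subtractf sum_divide_distrib[symmetric] sum_negf F G by (simp add: field_simps)
  qed
  \<comment> \<open>The diagonal gives the value at angle 0, and evenness of the cosine series
    doubles the rest.\<close>
  also have "(\<Sum>i\<in>A. \<Sum>j\<in>A. F i j) = real n * zeta 3 + 2 * (\<Sum>(k, l)\<in>U. F l k)"
  proof -
    have "F k l = F l k" for k l
      using clausen_C_minus[of 3 "2 * pi * (\<alpha> l - \<alpha> k)"] by (simp add: F_def algebra_simps)
    hence "(\<Sum>(k, l)\<in>U. F k l + F l k) = 2 * (\<Sum>(k, l)\<in>U. F l k)"
      by (simp add: sum_distrib_left case_prod_unfold)
    moreover have "F i i = zeta 3" for i by (simp add: F_def clausen_C_0)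
    ultimately show ?thesis
      unfolding A_def sum_square_split_diagonal U_def by simp
  qed
  \<comment> \<open>Oddness of the sine series kills the diagonal and pairs \<open>G l k\<close>
    with the difference of the offset sums at \<open>k\<close> and \<open>l\<close>, in which the
    sum of all \<alpha> and the constant cancel.\<close>
  also have "(\<Sum>i\<in>A. \<Sum>j\<in>A. G i j * (\<Sum>k\<in>A. d j k)) =
      (\<Sum>(k, l)\<in>U. G l k * (real n * (\<alpha> l - \<alpha> k) - (real l - real k)))"
  proof -
    have anti: "G k l = - G l k" for k l
      using clausen_S_minus[of 2 "2 * pi * (\<alpha> l - \<alpha> k)"] by (simp add: G_def algebra_simps)
    have "G i i = 0" for i by (simp add: G_def clausen_S_0)
    hence "(\<Sum>i\<in>A. \<Sum>j\<in>A. G i j * (\<Sum>k\<in>A. d j k)) =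
        (\<Sum>(k, l)\<in>U. G k l * (\<Sum>m\<in>A. d l m) + G l k * (\<Sum>m\<in>A. d k m))"
      unfolding A_def sum_square_split_diagonal U_def by simp
    also have "\<dots> = (\<Sum>(k, l)\<in>U. G l k * (real n * (\<alpha> l - \<alpha> k) - (real l - real k)))"
    proof (intro sum.cong refl, clarify)
      fix k l assume "(k, l) \<in> U"
      hence kl: "k \<in> {1..n}" "l \<in> {1..n}" by (auto simp: U_def)
      show "G k l * (\<Sum>m\<in>A. d l m) + G l k * (\<Sum>m\<in>A. d k m) =
          G l k * (real n * (\<alpha> l - \<alpha> k) - (real l - real k))"
        unfolding A_def d_def anti[of k l] sum_ordered_offset[OF kl(1)] sum_ordered_offset[OF kl(2)]
        by (simp add: field_simps)
    qed
    finally show ?thesis .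
  qed
  finally have "m3 P = 3 * pi ^ 2 * (- real n * (real n * zeta 3 + 2 * (\<Sum>(k, l)\<in>U. F l k)) / (2 * pi ^ 2)
      - (\<Sum>(k, l)\<in>U. G l k * (real n * (\<alpha> l - \<alpha> k) - (real l - real k))) / pi)" .
  also have "\<dots> = - (3 / 2) * (real n)\<^sup>2 * zeta 3 - 3 * real n * (\<Sum>(k, l)\<in>U. F l k)
      - 3 * pi * (\<Sum>(k, l)\<in>U. G l k * (real n * (\<alpha> l - \<alpha> k) - (real l - real k)))"
    by (simp add: field_simps power2_eq_square)
  finally show ?thesis by (simp only: F_def G_def U_def)
qed

end
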